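(* For every $n\ge1$, the algebra $\mathbb{C}_2^{\,n}$ (with componentwise operations) equipped with the real norm $|||\cdot|||_R$, and likewise equipped with the complex norm $|||\cdot|||_C$, is a modified Banach algebra; and $\mathbb{C}_2^{\,n}$ equipped with the real inner product $\langle\langle\cdot,\cdot\rangle\rangle_R$, and likewise equipped with the complex inner product $\langle\langle\cdot,\cdot\rangle\rangle_C$, is a Hilbert space.
   Context: $\mathbb{C}_0$ is the set of real numbers and $\mathbb{C}_1=\{a+i_1b: a,b\in\mathbb{C}_0\}$ the set of complex numbers, with complex conjugation written $\overline{\,\cdot\,}$. $\mathbb{C}_2$ is the set of bicomplex numbers $\xi=x_1+i_1x_2+i_2x_3+i_1i_2x_4$ with $x_1,\dots,x_4$ real, where $i_1^2=i_2^2=-1$ and $i_1i_2=i_2i_1$. Equivalently $\xi=z_1+i_2z_2$ with $z_1=x_1+i_1x_2$, $z_2=x_3+i_1x_4\in\mathbb{C}_1$; for $\alpha\in\mathbb{C}_1$, $\alpha\xi=\alpha z_1+i_2\alpha z_2$, and $(z_1+i_2z_2)\times(w_1+i_2w_2)=(z_1w_1-z_2w_2)+i_2(z_1w_2+z_2w_1)$. $\mathbb{C}_2^{\,n}$ is the set of $n$-tuples of bicomplex numbers; addition, multiplication by scalars in $\mathbb{C}_1$, and the product $P\times Q=(\xi_1\times\eta_1,\dots,\xi_n\times\eta_n)$ are componentwise, making it an algebra over $\mathbb{C}_1$ (and over $\mathbb{C}_0$). For $P=(\xi_1,\dots,\xi_n)$, $Q=(\eta_1,\dots,\eta_n)$ with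 $\xi_k={}^kx_1+i_1\,{}^kx_2+i_2\,{}^kx_3+i_1i_2\,{}^kx_4={}^kz_1+i_2\,{}^kz_2$ and $\eta_k={}^ky_1+i_1\,{}^ky_2+i_2\,{}^ky_3+i_1i_2\,{}^ky_4={}^kw_1+i_2\,{}^kw_2$, the real inner product is $\langle\langle P,Q\rangle\rangle_R=\sum_{k=1}^n\sum_{j=1}^4{}^kx_j\,{}^ky_j$ and the complex inner product is $\langle\langle P,Q\rangle\rangle_C=\sum_{k=1}^n\left({}^kz_1\,\overline{{}^kw_1}+{}^kz_2\,\overline{{}^kw_2}\right)$. The norms are $|||P|||_R=\sqrt{\langle\langle P,P\rangle\rangle_R}$ and $|||P|||_C=\sqrt{\langle\langle P,P\rangle\rangle_C}$. A modified Banach algebra is an algebra with a complete norm satisfying $\|ab\|\le\sqrt2\,\|a\|\|b\|$ for all $a,b$. Inner products are $\mathbb{C}_1$-valued, positive definite, conjugate symmetric, additive in the first argument and homogeneous in the first argument for scalars in $\mathbb{C}_1$; a Hilbert space is a vector space with such an inner product that is complete in the induced norm.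
   Formalization: For the real inner product, "Hilbert space" is taken over the real scalars (real-valued, symmetric, homogeneous for real scalars), since homogeneity for scalars in C_1 fails: <<i_1 P,P>>_R = 0 but i_1<<P,P>>_R is nonzero for nonzero P. *)

theory Defs
  imports "HOL-Analysis.Analysis"
begin

text \<open>
  The bicomplex number \<open>z1 + i2 z2\<close> is represented by the pair of complex numbers \<open>z1\<close>, \<open>z2\<close>; its
  real coordinates \<open>x1, x2, x3, x4\<close> (with respect to \<open>1, i1, i2, i1 i2\<close>) are \<open>Re z1\<close>, \<open>Im z1\<close>,
  \<open>Re z2\<close>, \<open>Im z2\<close>.
\<close>

datatype bicomplex = Bicomplex (bc1: complex) (bc2: complex)

lemma bicomplex_eq_iff: "\<xi> = \<eta> \<longleftrightarrow> bc1 \<xi> = bc1 \<eta> \<and> bc2 \<xi> = bc2 \<eta>"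
  by (cases \<xi>; cases \<eta>) simp

instantiation bicomplex :: "{comm_ring_1, real_vector}"
begin

definition zero_bicomplex where "0 = Bicomplex 0 0"
definition one_bicomplex where "1 = Bicomplex 1 0"
definition plus_bicomplex where "\<xi> + \<eta> = Bicomplex (bc1 \<xi> + bc1 \<eta>) (bc2 \<xi> + bc2 \<eta>)"
definition uminus_bicomplex where "- \<xi> = Bicomplex (- bc1 \<xi>) (- bc2 \<xi>)"
definition minus_bicomplex where "\<xi> - \<eta> = Bicomplex (bc1 \<xi> - bc1 \<eta>) (bc2 \<xi> - bc2 \<eta>)"
definition times_bicomplex where
  "\<xi> * \<eta> = Bicomplex (bc1 \<xi> * bc1 \<eta> - bc2 \<xi> * bc2 \<eta>) (bc1 \<xi> * bc2 \<eta> + bc2 \<xi> * bc1 \<eta>)"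
definition scaleR_bicomplex where "r *\<^sub>R \<xi> = Bicomplex (r *\<^sub>R bc1 \<xi>) (r *\<^sub>R bc2 \<xi>)"

instance
  by standard
    (simp_all add: bicomplex_eq_iff zero_bicomplex_def one_bicomplex_def plus_bicomplex_def
      uminus_bicomplex_def minus_bicomplex_def times_bicomplex_def scaleR_bicomplex_def
      algebra_simps)

end

definition scaleC_bicomplex :: "complex \<Rightarrow> bicomplex \<Rightarrow> bicomplex" where
  "scaleC_bicomplex \<alpha> \<xi> = Bicomplex (\<alpha> * bc1 \<xi>) (\<alpha> * bc2 \<xi>)"

text \<open>
  The space of \<open>n\<close>-tuples of bicomplex numbers is \<^typ>\<open>bicomplex ^ 'n\<close> with \<open>n = CARD('n)\<close>. Its
  addition, product and real scalar multiplication are the componentwise library operations.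
\<close>

definition scaleC_vec :: "complex \<Rightarrow> bicomplex ^ 'n \<Rightarrow> bicomplex ^ 'n" where
  "scaleC_vec \<alpha> P = (\<chi> k. scaleC_bicomplex \<alpha> (P $ k))"

definition real_inner_bc :: "bicomplex ^ 'n \<Rightarrow> bicomplex ^ 'n \<Rightarrow> real" where
  "real_inner_bc P Q =
    (\<Sum>k\<in>UNIV. Re (bc1 (P $ k)) * Re (bc1 (Q $ k)) + Im (bc1 (P $ k)) * Im (bc1 (Q $ k))
            + Re (bc2 (P $ k)) * Re (bc2 (Q $ k)) + Im (bc2 (P $ k)) * Im (bc2 (Q $ k)))"

definition complex_inner_bc :: "bicomplex ^ 'n \<Rightarrow> bicomplex ^ 'n \<Rightarrow> complex" where
  "complex_inner_bc P Q =
    (\<Sum>k\<in>UNIV. bc1 (P $ k) * cnj (bc1 (Q $ k)) + bc2 (P $ k) * cnj (bc2 (Q $ k)))"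

definition real_norm_bc :: "bicomplex ^ 'n \<Rightarrow> real" where
  "real_norm_bc P = sqrt (real_inner_bc P P)"

text \<open>
  As a complex inner product of a vector with itself is real, \<^const>\<open>Re\<close> below is only the passage
  from \<^typ>\<open>complex\<close> to \<^typ>\<open>real\<close>.
\<close>

definition complex_norm_bc :: "bicomplex ^ 'n \<Rightarrow> real" where
  "complex_norm_bc P = sqrt (Re (complex_inner_bc P P))"

text \<open>
  Norms and inner products are explicit parameters rather than type class operations, because
  the same type is to carry several of them. The scalar field is the argument type of \<open>scale\<close>;
  the ring structure of an algebra is that of the type class \<^class>\<open>ring\<close>.
\<close>

locale modified_banach_algebra = vector_space scale
  for scale :: "'k::real_normed_field \<Rightarrow> 'a::ring \<Rightarrow> 'a" +
  fixes nrm :: "'a \<Rightarrow> real"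
  assumes scale_mult_left: "scale c a * b = scale c (a * b)"
    and scale_mult_right: "a * scale c b = scale c (a * b)"
    and nrm_nonneg: "0 \<le> nrm a"
    and nrm_eq_0_iff: "nrm a = 0 \<longleftrightarrow> a = 0"
    and nrm_triangle: "nrm (a + b) \<le> nrm a + nrm b"
    and nrm_scale: "nrm (scale c a) = norm c * nrm a"
    and nrm_mult: "nrm (a * b) \<le> sqrt 2 * nrm a * nrm b"
    and complete: "Metric_space.mcomplete UNIV (\<lambda>a b. nrm (a - b))"

locale complex_hilbert_space = vector_space scale
  for scale :: "complex \<Rightarrow> 'a::ab_group_add \<Rightarrow> 'a" +
  fixes ip :: "'a \<Rightarrow> 'a \<Rightarrow> complex"
  assumes ip_self_real: "ip x x \<in> \<real>"
    and ip_pos: "x \<noteq> 0 \<Longrightarrow> 0 < Re (ip x x)"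
    and ip_conj_sym: "ip y x = cnj (ip x y)"
    and ip_add_left: "ip (x + y) z = ip x z + ip y z"
    and ip_scale_left: "ip (scale c x) y = c * ip x y"
    and complete: "Metric_space.mcomplete UNIV (\<lambda>x y. sqrt (Re (ip (x - y) (x - y))))"

text \<open>
  The version for real scalars: a real-valued inner product that is homogeneous over the reals.
  (A nonzero real-valued form cannot be homogeneous for complex scalars.)
\<close>

locale real_hilbert_space = vector_space scale
  for scale :: "real \<Rightarrow> 'a::ab_group_add \<Rightarrow> 'a" +
  fixes ip :: "'a \<Rightarrow> 'a \<Rightarrow> real"
  assumes ip_pos: "x \<noteq> 0 \<Longrightarrow> 0 < ip x x"
    and ip_sym: "ip y x = ip x y"
    and ip_add_left: "ip (x + y) z = ip x z + ip y z"
    and ip_scale_left: "ip (scale c x) y = c * ip x y"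
    and complete: "Metric_space.mcomplete UNIV (\<lambda>x y. sqrt (ip (x - y) (x - y)))"

end

theory Submission
  imports Defs
begin

text \<open>
  Forgetting the multiplication, an \<open>n\<close>-tuple of bicomplex numbers is a point of the Euclidean space
  \<open>(\<complex> \<times> \<complex>)\<^sup>n\<close>, and this identification is \<open>coords\<close> below. It carries \<^const>\<open>real_inner_bc\<close> to the
  Euclidean inner product, which is the real part of \<^const>\<open>complex_inner_bc\<close>; hence the two norms
  coincide, and both are the Euclidean norm (\<open>real_norm_bc_eq\<close>, \<open>complex_norm_bc_eq\<close>). All norm and
  inner product axioms, and completeness, are thereby inherited from a finite-dimensional space.

  Only submultiplicativity up to \<open>\<surd>2\<close> involves the bicomplex product. For single bicomplex numbers,
  each of the two components of \<open>\<xi> * \<eta>\<close> is bounded by \<open>norm \<xi> * norm \<eta>\<close> according to the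
  Cauchy-Schwarz inequality, so their joint Euclidean length is at most \<open>\<surd>2\<close> times that bound
  (\<open>norm_coords1_mult_le\<close>). Passing to tuples costs no further constant, because every component
  of a tuple is dominated by the whole tuple (\<open>norm_coords_mult_le\<close>).
\<close>

definition coords1 :: "bicomplex \<Rightarrow> complex \<times> complex" where
  "coords1 \<xi> = (bc1 \<xi>, bc2 \<xi>)"

definition coords :: "bicomplex ^ 'n \<Rightarrow> (complex \<times> complex) ^ 'n" where
  "coords P = (\<chi> k. coords1 (P $ k))"

lemma coords_nth [simp]: "coords P $ k = coords1 (P $ k)"
  by (simp add: coords_def)

lemma coords_add: "coords (P + Q) = coords P + coords Q"
  by (simp add: vec_eq_iff coords1_def plus_bicomplex_def)

lemma coords_diff: "coords (P - Q) = coords P - coords Q"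
  by (simp add: vec_eq_iff coords1_def minus_bicomplex_def)

lemma coords_scaleR: "coords (r *\<^sub>R P) = r *\<^sub>R coords P"
  by (simp add: vec_eq_iff coords1_def scaleR_bicomplex_def)

lemma coords_eq_0_iff: "coords P = 0 \<longleftrightarrow> P = 0"
  by (auto simp: vec_eq_iff coords1_def zero_bicomplex_def bicomplex_eq_iff zero_prod_def)

lemma surj_coords: "surj coords"
proof (rule surjI)
  show "coords (\<chi> k. Bicomplex (fst (v $ k)) (snd (v $ k))) = v" for v :: "(complex \<times> complex) ^ 'n"
    by (simp add: vec_eq_iff coords1_def)
qed

lemma real_inner_bc_eq: "real_inner_bc P Q = coords P \<bullet> coords Q"
  unfolding real_inner_bc_def inner_vec_def
  by (rule sum.cong) (simp_all add: coords1_def inner_complex_def)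

lemma Re_complex_inner_bc: "Re (complex_inner_bc P Q) = coords P \<bullet> coords Q"
  unfolding complex_inner_bc_def inner_vec_def Re_sum
  by (rule sum.cong) (simp_all add: coords1_def inner_complex_def)

lemma real_norm_bc_eq: "real_norm_bc P = norm (coords P)"
  by (simp add: real_norm_bc_def real_inner_bc_eq norm_eq_sqrt_inner)

lemma complex_norm_bc_eq: "complex_norm_bc P = norm (coords P)"
  by (simp add: complex_norm_bc_def Re_complex_inner_bc norm_eq_sqrt_inner)

lemma norm_coords_scaleC: "norm (coords (scaleC_vec c P)) = norm c * norm (coords P)"
proof -
  have "norm (coords1 (scaleC_bicomplex c \<xi>)) = norm c * norm (coords1 \<xi>)" for \<xi>
  proof -
    have "(norm (c * bc1 \<xi>))\<^sup>2 + (norm (c * bc2 \<xi>))\<^sup>2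
        = (norm c)\<^sup>2 * ((norm (bc1 \<xi>))\<^sup>2 + (norm (bc2 \<xi>))\<^sup>2)"
      by (simp add: norm_mult power_mult_distrib algebra_simps)
    then show ?thesis
      by (simp add: coords1_def scaleC_bicomplex_def norm_Pair real_sqrt_mult)
  qed
  then show ?thesis
    by (simp add: norm_vec_def scaleC_vec_def L2_set_right_distrib)
qed

text \<open>
  The constant is optimal: \<open>\<xi> = \<eta> = 1 + i1 i2\<close> has norm \<open>\<surd>2\<close>, while its square \<open>2 * \<xi>\<close> has norm
  \<open>2 * \<surd>2\<close>.
\<close>

lemma norm_coords1_mult_le: "norm (coords1 (\<xi> * \<eta>)) \<le> sqrt 2 * norm (coords1 \<xi>) * norm (coords1 \<eta>)"
proof -
  define N where "N = norm (coords1 \<xi>) * norm (coords1 \<eta>)"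
  have N: "N \<ge> 0" "N\<^sup>2 = ((norm (bc1 \<xi>))\<^sup>2 + (norm (bc2 \<xi>))\<^sup>2) * ((norm (bc1 \<eta>))\<^sup>2 + (norm (bc2 \<eta>))\<^sup>2)"
    by (simp_all add: N_def coords1_def norm_Pair power_mult_distrib)
  \<comment> \<open>Stated for arbitrary reals so as to serve the second component too, where the two moduli of
    \<open>\<eta>\<close> are exchanged.\<close>
  have cauchy: "a * c + b * d \<le> N"
    if "N\<^sup>2 = (a\<^sup>2 + b\<^sup>2) * (c\<^sup>2 + d\<^sup>2)" for a b c d :: real
  proof (rule power2_le_imp_le)
    have "(a\<^sup>2 + b\<^sup>2) * (c\<^sup>2 + d\<^sup>2) = (a * c + b * d)\<^sup>2 + (a * d - b * c)\<^sup>2"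
      by algebra
    with that show "(a * c + b * d)\<^sup>2 \<le> N\<^sup>2" by simp
  qed (rule N(1))
  have "norm (bc1 (\<xi> * \<eta>)) \<le> norm (bc1 \<xi>) * norm (bc1 \<eta>) + norm (bc2 \<xi>) * norm (bc2 \<eta>)"
    by (simp add: times_bicomplex_def norm_triangle_le_diff norm_mult)
  also have "\<dots> \<le> N"
    by (rule cauchy) (rule N(2))
  finally have first: "norm (bc1 (\<xi> * \<eta>)) \<le> N" .
  have "norm (bc2 (\<xi> * \<eta>)) \<le> norm (bc1 \<xi>) * norm (bc2 \<eta>) + norm (bc2 \<xi>) * norm (bc1 \<eta>)"
    by (simp add: times_bicomplex_def norm_triangle_le norm_mult)
  also have "\<dots> \<le> N"
    by (rule cauchy) (simp add: N(2) add.commute)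
  finally have second: "norm (bc2 (\<xi> * \<eta>)) \<le> N" .
  have "norm (coords1 (\<xi> * \<eta>)) \<le> sqrt (N\<^sup>2 + N\<^sup>2)"
    unfolding coords1_def norm_Pair
    by (intro real_sqrt_le_mono add_mono power_mono first second norm_ge_zero)
  also have "\<dots> = sqrt 2 * N"
    using N(1) by (simp add: real_sqrt_mult flip: mult_2)
  finally show ?thesis
    by (simp add: N_def mult.assoc)
qed

lemma norm_coords_mult_le: "norm (coords (P * Q)) \<le> sqrt 2 * norm (coords P) * norm (coords Q)"
proof -
  have "norm (coords1 (P $ k * Q $ k)) \<le> sqrt 2 * norm (coords P) * norm (coords1 (Q $ k))" for k
  proof -
    have "norm (coords1 (P $ k)) \<le> norm (coords P)"
      using Finite_Cartesian_Product.norm_nth_le[of "coords P" k] by simp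
    then show ?thesis
      by (intro order_trans[OF norm_coords1_mult_le] mult_right_mono mult_left_mono) auto
  qed
  then have "norm (coords (P * Q)) \<le> L2_set (\<lambda>k. sqrt 2 * norm (coords P) * norm (coords1 (Q $ k))) UNIV"
    unfolding norm_vec_def[of "coords (P * Q)"] by (intro L2_set_mono) auto
  also have "\<dots> = sqrt 2 * norm (coords P) * norm (coords Q)"
    by (simp add: norm_vec_def[of "coords Q"] L2_set_right_distrib)
  finally show ?thesis .
qed

text \<open>
  Surjectivity is what transports completeness: the limit in the Banach space must be the image of
  a point.
\<close>

lemma mcomplete_norm_pullback:
  fixes f :: "'a::ab_group_add \<Rightarrow> 'b::banach"
  assumes diff: "\<And>x y. f (x - y) = f x - f y" and zero: "\<And>x. f x = 0 \<longleftrightarrow> x = 0" and surj: "surj f"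
  shows "Metric_space.mcomplete UNIV (\<lambda>x y. norm (f (x - y)))"
proof -
  interpret Metric_space UNIV "\<lambda>x y. norm (f (x - y))"
  proof
    show "norm (f (x - y)) = 0 \<longleftrightarrow> x = y" for x y
      by (simp add: zero)
    show "norm (f (x - z)) \<le> norm (f (x - y)) + norm (f (y - z))" for x y z
      using norm_triangle_ineq[of "f x - f y" "f y - f z"] by (simp add: diff)
  qed (simp_all add: diff norm_minus_commute)
  show ?thesis
    unfolding mcomplete_def
  proof (intro allI impI)
    fix \<sigma> :: "nat \<Rightarrow> 'a"
    assume "MCauchy \<sigma>"
    then have "Cauchy (f \<circ> \<sigma>)"
      unfolding MCauchy_def Cauchy_def by (simp add: dist_norm diff)
    then obtain l where l: "(f \<circ> \<sigma>) \<longlonglongrightarrow> l"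
      using Cauchy_convergent convergent_def by blast
    from surj obtain x where "l = f x" by (rule surjE)
    with l have "limitin mtopology \<sigma> x sequentially"
      unfolding limit_metric_sequentially by (simp add: lim_sequentially dist_norm diff)
    then show "\<exists>x. limitin mtopology \<sigma> x sequentially" ..
  qed
qed

lemma mcomplete_coords: "Metric_space.mcomplete UNIV (\<lambda>P Q. norm (coords (P - Q)))"
  by (intro mcomplete_norm_pullback coords_diff coords_eq_0_iff surj_coords)

lemma vector_space_scaleC_vec: "vector_space scaleC_vec"
  by unfold_locales
    (simp_all add: vec_eq_iff scaleC_vec_def scaleC_bicomplex_def plus_bicomplex_def algebra_simps)

lemma vector_space_scaleR: "vector_space (scaleR :: real \<Rightarrow> 'a::real_vector \<Rightarrow> 'a)"
  by unfold_locales (simp_all add: scaleR_add_right scaleR_add_left)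

lemma modified_banach_algebra_scaleC:
  "modified_banach_algebra scaleC_vec (\<lambda>P. norm (coords P))"
proof (intro modified_banach_algebra.intro modified_banach_algebra_axioms.intro)
  show "vector_space scaleC_vec" by (rule vector_space_scaleC_vec)
  show "scaleC_vec c P * Q = scaleC_vec c (P * Q)" "P * scaleC_vec c Q = scaleC_vec c (P * Q)"
    for c and P Q :: "bicomplex ^ 'n"
    by (simp_all add: vec_eq_iff scaleC_vec_def scaleC_bicomplex_def times_bicomplex_def algebra_simps)
  show "norm (coords (P + Q)) \<le> norm (coords P) + norm (coords Q)" for P Q :: "bicomplex ^ 'n"
    by (simp add: coords_add norm_triangle_ineq)
qed (simp_all add: coords_eq_0_iff norm_coords_scaleC norm_coords_mult_le mcomplete_coords)

lemma modified_banach_algebra_scaleR: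
  "modified_banach_algebra scaleR (\<lambda>P. norm (coords P))"
proof (intro modified_banach_algebra.intro modified_banach_algebra_axioms.intro)
  show "vector_space (scaleR :: real \<Rightarrow> bicomplex ^ 'n \<Rightarrow> _)" by (rule vector_space_scaleR)
  show "(c *\<^sub>R P) * Q = c *\<^sub>R (P * Q)" "P * (c *\<^sub>R Q) = c *\<^sub>R (P * Q)"
    for c and P Q :: "bicomplex ^ 'n"
    by (simp_all add: vec_eq_iff scaleR_bicomplex_def times_bicomplex_def algebra_simps)
  show "norm (coords (P + Q)) \<le> norm (coords P) + norm (coords Q)" for P Q :: "bicomplex ^ 'n"
    by (simp add: coords_add norm_triangle_ineq)
qed (simp_all add: coords_eq_0_iff coords_scaleR norm_coords_mult_le mcomplete_coords)

lemma real_hilbert_space_scaleR: "real_hilbert_space scaleR real_inner_bc"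
proof (intro real_hilbert_space.intro real_hilbert_space_axioms.intro)
  show "Metric_space.mcomplete UNIV (\<lambda>P Q :: bicomplex ^ 'n. sqrt (real_inner_bc (P - Q) (P - Q)))"
    using mcomplete_coords by (simp add: real_inner_bc_eq norm_eq_sqrt_inner)
  show "real_inner_bc Q P = real_inner_bc P Q" for P Q :: "bicomplex ^ 'n"
    by (simp add: real_inner_bc_eq inner_commute)
qed (simp_all add: vector_space_scaleR real_inner_bc_eq coords_eq_0_iff coords_add coords_scaleR
    inner_add_left)

lemma complex_hilbert_space_scaleC: "complex_hilbert_space scaleC_vec complex_inner_bc"
proof (intro complex_hilbert_space.intro complex_hilbert_space_axioms.intro)
  show sym: "complex_inner_bc Q P = cnj (complex_inner_bc P Q)" for P Q :: "bicomplex ^ 'n"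
    by (simp add: complex_inner_bc_def mult.commute)
  show "complex_inner_bc P P \<in> \<real>" for P :: "bicomplex ^ 'n"
    using sym[of P P] by (simp add: Reals_cnj_iff)
  show "complex_inner_bc (P + Q) R = complex_inner_bc P R + complex_inner_bc Q R"
    for P Q R :: "bicomplex ^ 'n"
    by (simp add: complex_inner_bc_def plus_bicomplex_def algebra_simps flip: sum.distrib)
  show "complex_inner_bc (scaleC_vec c P) Q = c * complex_inner_bc P Q" for c and P Q :: "bicomplex ^ 'n"
    by (simp add: complex_inner_bc_def scaleC_vec_def scaleC_bicomplex_def sum_distrib_left algebra_simps)
  show "Metric_space.mcomplete UNIV
      (\<lambda>P Q :: bicomplex ^ 'n. sqrt (Re (complex_inner_bc (P - Q) (P - Q))))"
    using mcomplete_coords by (simp add: Re_complex_inner_bc norm_eq_sqrt_inner)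
qed (simp_all add: vector_space_scaleC_vec Re_complex_inner_bc coords_eq_0_iff)

theorem corollary2p29:
  shows "modified_banach_algebra scaleC_vec (real_norm_bc :: bicomplex ^ 'n \<Rightarrow> real)
    \<and> modified_banach_algebra scaleR (real_norm_bc :: bicomplex ^ 'n \<Rightarrow> real)
    \<and> modified_banach_algebra scaleC_vec (complex_norm_bc :: bicomplex ^ 'n \<Rightarrow> real)
    \<and> modified_banach_algebra scaleR (complex_norm_bc :: bicomplex ^ 'n \<Rightarrow> real)
    \<and> real_hilbert_space scaleR (real_inner_bc :: bicomplex ^ 'n \<Rightarrow> bicomplex ^ 'n \<Rightarrow> real)
    \<and> complex_hilbert_space scaleC_vec (complex_inner_bc :: bicomplex ^ 'n \<Rightarrow> bicomplex ^ 'n \<Rightarrow> complex)"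
proof -
  have norms: "real_norm_bc = (\<lambda>P :: bicomplex ^ 'n. norm (coords P))"
       "complex_norm_bc = (\<lambda>P :: bicomplex ^ 'n. norm (coords P))"
    by (simp_all add: fun_eq_iff real_norm_bc_eq complex_norm_bc_eq)
  show ?thesis
    unfolding norms
    by (intro conjI modified_banach_algebra_scaleC modified_banach_algebra_scaleR
      real_hilbert_space_scaleR complex_hilbert_space_scaleC)
qed

end
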